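(* Let $k\geq 1$ and $n\geq 2k$ be integers, and let $\mathcal{D}$ be the set of $k$-partition diagrams without blocks of size one. For any $d_1,d_2\in\mathcal{D}$ there are scalars $c_{d_1,d_2}^{d}\in\mathbb{C}$ such that $$\bar d_1\,\bar d_2=\sum_{d\in\mathcal{D},\ d\leq d_1d_2}c_{d_1,d_2}^{d}\,\bar d ,$$ where $d\leq d_1d_2$ means that every block of the diagram $d_1d_2$ is a union of blocks of $d$, i.e. $d$ is a refinement of $d_1d_2$.
   Context: Let $[k]=\{1,\dots,k\}$ and $[k']=\{1',\dots,k'\}$ be disjoint sets. A $k$-partition diagram is a set partition $d$ of $[k]\cup[k']$, drawn as a graph with top row of vertices $1,\dots,k$ and bottom row $1',\dots,k'$, whose connected components are the blocks of $d$. The diagram $d_1d_2$ is obtained by placing $d_1$ above $d_2$, identifying the bottom vertices of $d_1$ with the top vertices of $d_2$, and then deleting the middle vertices (in the partition algebra, the product is this diagram times a scalar $n^c$, $c$ being the number of components consisting only of middle vertices; in the relation $d\le d_1d_2$ only the underlying diagram matters). Let $V$ be the permutation representation of $S_n$ over $\mathbb{C}$ with basis $v_1,\dots,v_n$. A diagram $d$ acts on $V^{\otimes k}$ by $$d\cdot(v_{i_{1'}}\otimes\cdots\otimes v_{i_{k'}})=\sum v_{i_1}\otimes\cdots\otimes v_{i_k},$$ where the sum is over all $(i_1,\dots,i_k)\in\{1,\dots,n\}^k$ such that $i_s=i_t$ whenever $s,t\in[k]\cup[k']$ lie in the same block of $d$. Let $W\subset V$ be the irreducible $S_n$-submodule spanned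 by $w_j=v_j-v_1$, $2\leq j\leq n$ (isomorphic to $S^{(n-1,1)}$). Let $\pi:V\to W$, $\pi(v_i)=v_i-\frac1n\sum_{j=1}^n v_j$. For a diagram $d$, $\bar d$ denotes the operator $\pi^{\otimes k}\circ d$ restricted to $W^{\otimes k}$; it is an element of $QP_k(n)=\mathrm{End}_{S_n}(W^{\otimes k})$, and the product $\bar d_1\bar d_2$ is composition of operators. *)

theory Defs
  imports Complex_Main "HOL-Library.FuncSet" "HOL-Library.Disjoint_Sets"
    "HOL-Library.Function_Algebras"
begin

section \<open>Partition diagrams\<close>

text \<open>\<open>Top s\<close> is the vertex $s$ and \<open>Bot s\<close> is the vertex $s'$.\<close>

datatype vertex = Top nat | Bot nat

type_synonym diagram = "vertex set set"

definition verts :: "nat \<Rightarrow> vertex set" where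
  "verts k = Top ` {1..k} \<union> Bot ` {1..k}"

definition partition_diagram :: "nat \<Rightarrow> diagram \<Rightarrow> bool" where
  "partition_diagram k d \<longleftrightarrow> partition_on (verts k) d"

definition nonsingleton_diagrams :: "nat \<Rightarrow> diagram set" where
  "nonsingleton_diagrams k = {d. partition_diagram k d \<and> (\<forall>B\<in>d. card B \<noteq> 1)}"

text \<open>The vertices of the three-row graph obtained by placing one diagram above another and
  identifying the adjacent rows.\<close>

datatype stack_vertex = Upper nat | Middle nat | Lower nat

fun in_above :: "vertex \<Rightarrow> stack_vertex" where
  "in_above (Top s) = Upper s"
| "in_above (Bot s) = Middle s"

fun in_below :: "vertex \<Rightarrow> stack_vertex" where
  "in_below (Top s) = Middle s"
| "in_below (Bot s) = Lower s"

fun in_outer :: "vertex \<Rightarrow> stack_vertex" where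
  "in_outer (Top s) = Upper s"
| "in_outer (Bot s) = Lower s"

definition stack_edges :: "diagram \<Rightarrow> diagram \<Rightarrow> (stack_vertex \<times> stack_vertex) set" where
  "stack_edges d1 d2 =
     {(in_above x, in_above y) | x y. \<exists>B\<in>d1. x \<in> B \<and> y \<in> B} \<union>
     {(in_below x, in_below y) | x y. \<exists>B\<in>d2. x \<in> B \<and> y \<in> B}"

text \<open>The underlying diagram of the product; components consisting only of middle vertices
  disappear.\<close>

definition diagram_mult :: "nat \<Rightarrow> diagram \<Rightarrow> diagram \<Rightarrow> diagram" where
  "diagram_mult k d1 d2 =
     verts k // {(x, y). x \<in> verts k \<and> y \<in> verts k \<and>
                         (in_outer x, in_outer y) \<in> (stack_edges d1 d2)\<^sup>*}"

definition diagram_le :: "diagram \<Rightarrow> diagram \<Rightarrow> bool" where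
  "diagram_le d e \<longleftrightarrow> (\<forall>B\<in>e. \<exists>C\<subseteq>d. B = \<Union>C)"

lemma partition_diagram_mult: "partition_diagram k (diagram_mult k d1 d2)"
proof -
  have "sym (stack_edges d1 d2)"
    unfolding stack_edges_def sym_def by blast
  then have s: "sym ((stack_edges d1 d2)\<^sup>*)"
    by (rule sym_rtrancl)
  have "equiv (verts k) {(x, y). x \<in> verts k \<and> y \<in> verts k \<and>
                         (in_outer x, in_outer y) \<in> (stack_edges d1 d2)\<^sup>*}"
    by (rule equivI) (auto simp: refl_on_def intro!: symI transI dest: symD[OF s])
  then show ?thesis
    unfolding partition_diagram_def diagram_mult_def by (rule partition_on_quotient)
qed


section \<open>The permutation representation and its tensor powers\<close>

text \<open>Functions \<open>'a \<Rightarrow> complex\<close> form a complex vector space. The permutation representation $V$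
  consists of the functions \<open>nat \<Rightarrow> complex\<close> supported on $\{1,\dots,n\}$, and $V^{\otimes k}$
  of the functions supported on the multi-indices $\{1,\dots,k\}\to\{1,\dots,n\}$, where
  $T(i)$ is the coefficient of $v_{i_1}\otimes\cdots\otimes v_{i_k}$ in $T$.\<close>

definition cscale :: "complex \<Rightarrow> ('a \<Rightarrow> complex) \<Rightarrow> 'a \<Rightarrow> complex" (infixr "*\<^sub>c" 75) where
  "c *\<^sub>c f = (\<lambda>x. c * f x)"

global_interpretation cfun: vector_space "cscale :: complex \<Rightarrow> ('a \<Rightarrow> complex) \<Rightarrow> 'a \<Rightarrow> complex"
  by unfold_locales (auto simp: cscale_def fun_eq_iff algebra_simps)

definition basis_vec :: "nat \<Rightarrow> nat \<Rightarrow> complex" where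
  "basis_vec i = (\<lambda>x. if x = i then 1 else 0)"

type_synonym multi_index = "nat \<Rightarrow> nat"
type_synonym tensor = "multi_index \<Rightarrow> complex"

definition multi_indices :: "nat \<Rightarrow> nat \<Rightarrow> multi_index set" where
  "multi_indices n k = {1..k} \<rightarrow>\<^sub>E {1..n}"

text \<open>The elementary tensor $x_1\otimes\cdots\otimes x_k$.\<close>

definition elem_tensor :: "nat \<Rightarrow> (nat \<Rightarrow> nat \<Rightarrow> complex) \<Rightarrow> tensor" where
  "elem_tensor k x = (\<lambda>i. if i \<in> extensional {1..k} then (\<Prod>s=1..k. x s (i s)) else 0)"

definition W :: "nat \<Rightarrow> (nat \<Rightarrow> complex) set" where
  "W n = cfun.span {basis_vec j - basis_vec 1 | j. 2 \<le> j \<and> j \<le> n}"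

definition W_tensor :: "nat \<Rightarrow> nat \<Rightarrow> tensor set" where
  "W_tensor n k = cfun.span {elem_tensor k x | x. \<forall>s\<in>{1..k}. x s \<in> W n}"

text \<open>The label of a vertex when the top row is labelled by \<open>i\<close> and the bottom row by \<open>j\<close>.\<close>

fun label :: "multi_index \<Rightarrow> multi_index \<Rightarrow> vertex \<Rightarrow> nat" where
  "label i j (Top s) = i s"
| "label i j (Bot s) = j s"

definition compatible :: "diagram \<Rightarrow> multi_index \<Rightarrow> multi_index \<Rightarrow> bool" where
  "compatible d i j \<longleftrightarrow> (\<forall>B\<in>d. \<forall>x\<in>B. \<forall>y\<in>B. label i j x = label i j y)"

text \<open>The next three operators are the linear extensions of their prescribed values on the basis
  vectors $v_i$, respectively on the basis tensors $v_{j_1}\otimes\cdots\otimes v_{j_k}$.\<close>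

definition diagram_act :: "nat \<Rightarrow> nat \<Rightarrow> diagram \<Rightarrow> tensor \<Rightarrow> tensor" where
  "diagram_act n k d T =
     (\<Sum>j\<in>multi_indices n k. T j *\<^sub>c
        (\<Sum>i\<in>{i\<in>multi_indices n k. compatible d i j}. elem_tensor k (\<lambda>s. basis_vec (i s))))"

definition proj :: "nat \<Rightarrow> (nat \<Rightarrow> complex) \<Rightarrow> nat \<Rightarrow> complex" where
  "proj n x = (\<Sum>i=1..n. x i *\<^sub>c (basis_vec i - (1 / of_nat n) *\<^sub>c (\<Sum>j=1..n. basis_vec j)))"

definition proj_tensor :: "nat \<Rightarrow> nat \<Rightarrow> tensor \<Rightarrow> tensor" where
  "proj_tensor n k T =
     (\<Sum>j\<in>multi_indices n k. T j *\<^sub>c elem_tensor k (\<lambda>s. proj n (basis_vec (j s))))"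

text \<open>The operator $\bar d$ on $W^{\otimes k}$ (an extensional function, so that equality of such
  functions is equality of operators on $W^{\otimes k}$).\<close>

definition bar :: "nat \<Rightarrow> nat \<Rightarrow> diagram \<Rightarrow> tensor \<Rightarrow> tensor" where
  "bar n k d = (\<lambda>T\<in>W_tensor n k. proj_tensor n k (diagram_act n k d T))"

lemma proj_basis_vec:
  assumes "i \<in> {1..n}"
  shows "proj n (basis_vec i) = basis_vec i - (1 / of_nat n) *\<^sub>c (\<Sum>j=1..n. basis_vec j)"
proof -
  have "proj n (basis_vec i) =
      (\<Sum>m=1..n. if i = m then basis_vec m - (1 / of_nat n) *\<^sub>c (\<Sum>j=1..n. basis_vec j) else 0)"
    unfolding proj_def by (rule sum.cong) (auto simp: basis_vec_def cscale_def fun_eq_iff)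
  then show ?thesis
    using assms by (simp only: sum.delta' finite_atLeastAtMost if_True)
qed

lemma proj_basis_vec_in_W:
  assumes "i \<in> {1..n}"
  shows "proj n (basis_vec i) \<in> W n"
proof -
  have n: "(of_nat n :: complex) \<noteq> 0"
    using assms by auto
  have diff: "basis_vec j - basis_vec 1 \<in> W n" if "j \<in> {1..n}" for j
  proof (cases "j = 1")
    case True
    then show ?thesis
      unfolding W_def by (simp add: cfun.span_zero)
  next
    case False
    with that show ?thesis
      unfolding W_def by (intro cfun.span_base) auto
  qed
  have "proj n (basis_vec i) =
      (1 / of_nat n) *\<^sub>c (\<Sum>j=1..n. (basis_vec i - basis_vec 1) - (basis_vec j - basis_vec 1))"
    using n by (simp add: proj_basis_vec[OF assms] sum_subtractf cscale_def fun_eq_iff field_simps)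
  moreover have "(basis_vec i - basis_vec 1) - (basis_vec j - basis_vec 1) \<in> W n"
    if "j \<in> {1..n}" for j
    using diff[OF assms] diff[OF that] unfolding W_def by (rule cfun.span_diff)
  ultimately show ?thesis
    unfolding W_def by (metis (no_types, lifting) cfun.span_scale cfun.span_sum)
qed

lemma bar_funcset: "bar n k d \<in> W_tensor n k \<rightarrow>\<^sub>E W_tensor n k"
proof -
  have "proj_tensor n k T \<in> W_tensor n k" for T
    unfolding proj_tensor_def W_tensor_def
  proof (intro cfun.span_sum cfun.span_scale cfun.span_base)
    fix j assume "j \<in> multi_indices n k"
    then have "\<forall>s\<in>{1..k}. proj n (basis_vec (j s)) \<in> W n"
      unfolding multi_indices_def by (intro ballI proj_basis_vec_in_W) auto
    then show "elem_tensor k (\<lambda>s. proj n (basis_vec (j s)))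
        \<in> {elem_tensor k x | x. \<forall>s\<in>{1..k}. x s \<in> W n}"
      by blast
  qed
  then show ?thesis
    unfolding bar_def by auto
qed

end

theory Submission
  imports Defs
begin

text \<open>
  On $W^{\otimes k}$ the product $\bar d_1\bar d_2$ is
  $\pi^{\otimes k}\, d_1\, \pi^{\otimes k}\, d_2$, and the inner projection can be multiplied
  out. Since $\pi = 1 - \frac1n J$ with $J$ the all-ones matrix,
  $$\pi^{\otimes k} = \sum_{S\subseteq\{1,\dots,k\}} \Bigl(-\frac1n\Bigr)^{|S|} e_S,$$
  where $e_S$ is the diagram with edges $\{s,s'\}$ for $s\notin S$ and singletons $s$, $s'$ for
  $s\in S$. Now $d_1 e_S d_2$ is a scalar multiple of a single diagram $d_S$, obtained from the
  stacking of $d_1$ on $d_2$ by cutting the middle vertices in $S$ in two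
  (\<open>diagram_act_proj_diagram_act\<close>). Cutting can only disconnect vertices, so $d_S\le d_1d_2$
  (\<open>cut_mult_le\<close>). Hence $\bar d_1\bar d_2$ is a linear combination of operators
  $\bar d_S$ with $d_S\le d_1d_2$.

  Some $d_S$ may have blocks of size one, but then $\bar d_S = 0$
  (\<open>proj_diagram_act_eq_0_if_singleton\<close>): a singleton in the top row produces a tensor factor
  $\sum_i v_i$, which $\pi$ kills, and a singleton in the bottom row sums the coordinates of a
  tensor factor, and that sum vanishes on $W$.

  That $d_1e_Sd_2$ is a multiple of one diagram is seen on matrix entries. An entry of the product
  counts the labellings of the inner vertices of a graph that extend a given labelling of its outer
  vertices and are constant on components. If the outer labelling is consistent, this
  number does not depend on it (\<open>card_label_extensions\<close>), because only the components without
  outer vertices leave a choice.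
\<close>

section \<open>Counting labellings of a graph with prescribed boundary values\<close>

lemma rtrancl_label_eq:
  assumes "(x, y) \<in> R\<^sup>*" and "\<forall>(x, y)\<in>R. f x = f y"
  shows "f x = f y"
  using assms(1) by induction (use assms(2) in auto)

text \<open>A component that meets the boundary \<open>Y\<close> takes its label from \<open>g\<close>, and the other components
  are labelled freely. So restricting a labelling to the vertices not connected to \<open>Y\<close> loses
  nothing. What matters is that the right-hand side does not mention \<open>g\<close>.\<close>

lemma card_label_extensions:
  fixes R :: "('v \<times> 'v) set" and g :: "'v \<Rightarrow> 'b"
  assumes "sym R" and "R \<subseteq> X \<times> X" and "Y \<subseteq> X" and "g ` Y \<subseteq> A"
    and g: "\<And>x y. x \<in> Y \<Longrightarrow> y \<in> Y \<Longrightarrow> (x, y) \<in> R\<^sup>* \<Longrightarrow> g x = g y"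
  shows "card {f \<in> X \<rightarrow>\<^sub>E A. (\<forall>(x, y)\<in>R. f x = f y) \<and> (\<forall>x\<in>Y. f x = g x)} =
         card {f \<in> (X - R\<^sup>* `` Y) \<rightarrow>\<^sub>E A. \<forall>(x, y)\<in>R. x \<notin> R\<^sup>* `` Y \<longrightarrow> f x = f y}"
    (is "card ?F = card ?G")
proof -
  define Z where "Z = R\<^sup>* `` Y"
  define r where "r x = (SOME z. z \<in> Y \<and> (z, x) \<in> R\<^sup>*)" for x
  have r: "r x \<in> Y \<and> (r x, x) \<in> R\<^sup>*" if "x \<in> Z" for x
    unfolding r_def by (rule someI_ex) (use that Z_def in auto)
  have YZ: "Y \<subseteq> Z"
    unfolding Z_def by auto
  have Z_closed: "x \<in> Z \<longleftrightarrow> y \<in> Z" if "(x, y) \<in> R" for x y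
  proof -
    have "(y, x) \<in> R"
      using that \<open>sym R\<close> by (blast dest: symD)
    with that show ?thesis
      unfolding Z_def by (auto intro: rtrancl_into_rtrancl)
  qed
  have gr: "g (r x) = g z" if "z \<in> Y" "(z, x) \<in> R\<^sup>*" for x z
  proof -
    have "x \<in> Z"
      using that unfolding Z_def by auto
    then have "(x, r x) \<in> R\<^sup>*" "r x \<in> Y"
      using r[of x] sym_rtrancl[OF \<open>sym R\<close>] by (auto dest: symD)
    then have "(r x, z) \<in> R\<^sup>*"
      using that(2) sym_rtrancl[OF \<open>sym R\<close>] by (meson rtrancl_trans symD)
    with \<open>r x \<in> Y\<close> that(1) show ?thesis
      by (intro g)
  qed
  \<comment> \<open>The inverse of restriction: on a component meeting \<open>Y\<close>, use the value of \<open>g\<close> at the chosen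
    boundary vertex; by \<open>gr\<close> the choice is immaterial.\<close>
  define ext where "ext f = (\<lambda>x\<in>X. if x \<in> Z then g (r x) else f x)" for f
  have "bij_betw (\<lambda>f. restrict f (X - Z)) ?F ?G"
  proof (rule bij_betw_byWitness[where f' = ext])
    show "\<forall>f\<in>?F. ext (restrict f (X - Z)) = f"
    proof
      fix f assume f: "f \<in> ?F"
      have "g (r x) = f x" if "x \<in> Z" for x
        using rtrancl_label_eq[of "r x" x R f] r[OF that] f by auto
      with f show "ext (restrict f (X - Z)) = f"
        by (auto simp: ext_def fun_eq_iff PiE_def extensional_def)
    qed
    show "\<forall>f\<in>?G. restrict (ext f) (X - Z) = f"
      by (auto simp: ext_def fun_eq_iff PiE_def extensional_def Z_def)
    show "(\<lambda>f. restrict f (X - Z)) ` ?F \<subseteq> ?G"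
    proof
      fix h assume "h \<in> (\<lambda>f. restrict f (X - Z)) ` ?F"
      then obtain f where f: "f \<in> ?F" and h: "h = restrict f (X - Z)"
        by blast
      have "h \<in> (X - Z) \<rightarrow>\<^sub>E A"
        using f unfolding h by auto
      moreover have "\<forall>(x, y)\<in>R. x \<notin> Z \<longrightarrow> h x = h y"
        using f Z_closed assms(2) unfolding h by auto
      ultimately show "h \<in> ?G"
        unfolding Z_def by blast
    qed
    show "ext ` ?G \<subseteq> ?F"
    proof
      fix h assume "h \<in> ext ` ?G"
      then obtain f where f: "f \<in> (X - Z) \<rightarrow>\<^sub>E A" "\<And>x y. (x, y) \<in> R \<Longrightarrow> x \<notin> Z \<Longrightarrow> f x = f y"
        and h: "h = ext f"
        unfolding Z_def by blast
      have "h \<in> X \<rightarrow>\<^sub>E A"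
        using f(1) r assms(4) unfolding h ext_def by (auto simp: image_subset_iff PiE_iff)
      moreover have "h x = h y" if xy: "(x, y) \<in> R" for x y
      proof (cases "x \<in> Z")
        case True
        then have "g (r y) = g (r x)"
          using r[OF True] xy by (intro gr) auto
        with True xy Z_closed[OF xy] assms(2) show ?thesis
          unfolding h ext_def by auto
      next
        case False
        with xy Z_closed[OF xy] assms(2) f(2)[OF xy] show ?thesis
          unfolding h ext_def by auto
      qed
      moreover have "h x = g x" if "x \<in> Y" for x
        using gr[of x x] that YZ assms(3) unfolding h ext_def by auto
      ultimately show "h \<in> ?F"
        by blast
    qed
  qed
  then show ?thesis
    by (rule bij_betw_same_card)
qed


section \<open>Stacking two diagrams with some middle edges cut\<close>

text \<open>The graph of the product $d_1e_Sd_2$ has four rows. They are encoded as two copies of the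
  vertices, the left summand for $d_1$ and the right one for $d_2$, so that a label of a middle
  vertex \<open>s\<close> may differ in the two copies exactly when \<open>s \<in> S\<close>.\<close>

definition cut_edges :: "nat \<Rightarrow> nat set \<Rightarrow> diagram \<Rightarrow> diagram \<Rightarrow> ((vertex + vertex) \<times> (vertex + vertex)) set"
  where "cut_edges k S d1 d2 =
     {(Inl x, Inl y) | x y. \<exists>B\<in>d1. x \<in> B \<and> y \<in> B} \<union>
     {(Inr x, Inr y) | x y. \<exists>B\<in>d2. x \<in> B \<and> y \<in> B} \<union>
     (\<lambda>s. (Inl (Bot s), Inr (Top s))) ` ({1..k} - S) \<union>
     (\<lambda>s. (Inr (Top s), Inl (Bot s))) ` ({1..k} - S)"

fun outer :: "vertex \<Rightarrow> vertex + vertex" where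
  "outer (Top s) = Inl (Top s)"
| "outer (Bot s) = Inr (Bot s)"

definition cut_mult :: "nat \<Rightarrow> nat set \<Rightarrow> diagram \<Rightarrow> diagram \<Rightarrow> diagram" where
  "cut_mult k S d1 d2 =
     verts k // {(x, y). x \<in> verts k \<and> y \<in> verts k \<and>
                         (outer x, outer y) \<in> (cut_edges k S d1 d2)\<^sup>*}"

lemma sym_cut_edges: "sym (cut_edges k S d1 d2)"
  by (intro symI) (auto simp: cut_edges_def)

lemma equiv_connected:
  assumes "sym R"
  shows "equiv A {(x, y). x \<in> A \<and> y \<in> A \<and> (f x, f y) \<in> R\<^sup>*}"
  using symD[OF sym_rtrancl[OF assms]]
  by (intro equivI) (auto simp: refl_on_def intro!: symI transI)

lemma equiv_cut:
  "equiv (verts k) {(x, y). x \<in> verts k \<and> y \<in> verts k \<and>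
                            (outer x, outer y) \<in> (cut_edges k S d1 d2)\<^sup>*}"
  by (intro equiv_connected sym_cut_edges)

lemma partition_diagram_cut_mult: "partition_diagram k (cut_mult k S d1 d2)"
  unfolding partition_diagram_def cut_mult_def by (intro partition_on_quotient equiv_cut)

text \<open>Merging the two middle rows maps the cut graph to the graph that defines \<open>diagram_mult\<close>. The
  edges between the two middle rows collapse to points.\<close>

fun reglue :: "vertex + vertex \<Rightarrow> stack_vertex" where
  "reglue (Inl x) = in_above x"
| "reglue (Inr x) = in_below x"

lemma reglue_outer: "reglue (outer x) = in_outer x"
  by (cases x) auto

lemma rtrancl_reglue:
  assumes "(x, y) \<in> (cut_edges k S d1 d2)\<^sup>*"
  shows "(reglue x, reglue y) \<in> (stack_edges d1 d2)\<^sup>*"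
  using assms
proof induction
  case (step y z)
  from step.hyps(2) have "reglue y = reglue z \<or> (reglue y, reglue z) \<in> stack_edges d1 d2"
    unfolding cut_edges_def stack_edges_def by auto
  with step.IH show ?case
    by (metis rtrancl.rtrancl_into_rtrancl)
qed auto

lemma quotient_refines:
  assumes "equiv A r" and "equiv A r'" and "r \<subseteq> r'"
  shows "diagram_le (A // r) (A // r')"
  unfolding diagram_le_def
proof
  fix B assume "B \<in> A // r'"
  then obtain x where x: "x \<in> A" "B = r' `` {x}"
    by (auto elim: quotientE)
  have "r' `` {x} = \<Union> ((\<lambda>y. r `` {y}) ` (r' `` {x}))"
  proof
    show "r' `` {x} \<subseteq> \<Union> ((\<lambda>y. r `` {y}) ` (r' `` {x}))"
      using assms by (auto simp: equiv_def refl_on_def)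
    show "\<Union> ((\<lambda>y. r `` {y}) ` (r' `` {x})) \<subseteq> r' `` {x}"
      using assms by (auto simp: equiv_def trans_def)
  qed
  moreover have "(\<lambda>y. r `` {y}) ` (r' `` {x}) \<subseteq> A // r"
    using assms(2) by (auto simp: equiv_def refl_on_def intro!: quotientI)
  ultimately show "\<exists>C\<subseteq>A // r. B = \<Union>C"
    using x by blast
qed

text \<open>Vertices connected in the cut graph remain connected after regluing.\<close>

lemma cut_mult_le: "diagram_le (cut_mult k S d1 d2) (diagram_mult k d1 d2)"
  unfolding cut_mult_def diagram_mult_def
proof (rule quotient_refines[OF equiv_cut])
  have "sym (stack_edges d1 d2)"
    unfolding stack_edges_def sym_def by blast
  then show "equiv (verts k) {(x, y). x \<in> verts k \<and> y \<in> verts k \<and>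
                         (in_outer x, in_outer y) \<in> (stack_edges d1 d2)\<^sup>*}"
    by (rule equiv_connected)
qed (auto simp flip: reglue_outer intro: rtrancl_reglue)

lemma compatible_cut_mult:
  "compatible (cut_mult k S d1 d2) i l \<longleftrightarrow>
   (\<forall>x\<in>verts k. \<forall>y\<in>verts k. (outer x, outer y) \<in> (cut_edges k S d1 d2)\<^sup>* \<longrightarrow>
      label i l x = label i l y)"
  (is "_ \<longleftrightarrow> ?R")
proof
  assume c: "compatible (cut_mult k S d1 d2) i l"
  show ?R
  proof (intro ballI impI)
    fix x y assume xy: "x \<in> verts k" "y \<in> verts k" "(outer x, outer y) \<in> (cut_edges k S d1 d2)\<^sup>*"
    let ?r = "{(x, y). x \<in> verts k \<and> y \<in> verts k \<and> (outer x, outer y) \<in> (cut_edges k S d1 d2)\<^sup>*}"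
    have "?r `` {x} \<in> cut_mult k S d1 d2"
      unfolding cut_mult_def using xy(1) by (rule quotientI)
    moreover have "x \<in> ?r `` {x}" "y \<in> ?r `` {x}"
      using xy by auto
    ultimately show "label i l x = label i l y"
      by (rule c[unfolded compatible_def, rule_format])
  qed
next
  assume R: ?R
  show "compatible (cut_mult k S d1 d2) i l"
    unfolding compatible_def
  proof (intro ballI)
    fix B x y assume "B \<in> cut_mult k S d1 d2" "x \<in> B" "y \<in> B"
    with quotient_eq_iff[OF equiv_cut, of B k S d1 d2 B x y] R show "label i l x = label i l y"
      unfolding cut_mult_def by auto
  qed
qed

text \<open>The count is the entry at \<open>(i, l)\<close> of the matrix of $d_1e_Sd_2$. Labellings of the two middle
  rows are labellings of the whole cut graph with the outer rows fixed, so the previous section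
  applies.\<close>

lemma card_inner_labels:
  assumes "partition_diagram k d1" and "partition_diagram k d2"
  shows "\<exists>c. \<forall>i\<in>multi_indices n k. \<forall>l\<in>multi_indices n k.
           card {(m, j) \<in> multi_indices n k \<times> multi_indices n k.
                   compatible d1 i m \<and> compatible d2 j l \<and> (\<forall>s\<in>{1..k} - S. m s = j s)} =
           (if compatible (cut_mult k S d1 d2) i l then c else 0)"
proof (intro exI ballI)
  fix i l assume i: "i \<in> multi_indices n k" and l: "l \<in> multi_indices n k"
  let ?R = "cut_edges k S d1 d2" and ?X = "Inl ` verts k \<union> Inr ` verts k"
    and ?Y = "outer ` verts k" and ?A = "{1..n}"
  let ?P = "{(m, j) \<in> multi_indices n k \<times> multi_indices n k.
               compatible d1 i m \<and> compatible d2 j l \<and> (\<forall>s\<in>{1..k} - S. m s = j s)}"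
  define g where "g = case_sum (label i i) (label l l)"
  let ?F = "{f \<in> ?X \<rightarrow>\<^sub>E ?A. (\<forall>(x, y)\<in>?R. f x = f y) \<and> (\<forall>x\<in>?Y. f x = g x)}"
  have d: "x \<in> verts k" if "x \<in> B" "B \<in> d1 \<union> d2" for x B
    using assms that unfolding partition_diagram_def partition_on_def by auto
  have RX: "?R \<subseteq> ?X \<times> ?X"
  proof -
    have "Bot s \<in> verts k" "Top s \<in> verts k" if "s \<in> {1..k}" for s
      using that unfolding verts_def by auto
    then show ?thesis
      unfolding cut_edges_def by (auto intro: d)
  qed
  have YX: "?Y \<subseteq> ?X"
    by (auto simp: verts_def)
  have g_outer: "g (outer x) = label i l x" for x
    by (cases x) (auto simp: g_def)
  have lab: "label a b x \<in> {1..n}"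
    if "a \<in> multi_indices n k" "b \<in> multi_indices n k" "x \<in> verts k" for a b x
    using that unfolding multi_indices_def verts_def by (auto simp: PiE_iff)
  have "bij_betw (\<lambda>(m, j). restrict (case_sum (label i m) (label j l)) ?X) ?P ?F"
  proof (rule bij_betw_byWitness[where
        f' = "\<lambda>f. (\<lambda>s\<in>{1..k}. f (Inl (Bot s)), \<lambda>s\<in>{1..k}. f (Inr (Top s)))"])
    show "\<forall>p\<in>?P. (\<lambda>f. (\<lambda>s\<in>{1..k}. f (Inl (Bot s)), \<lambda>s\<in>{1..k}. f (Inr (Top s))))
            ((\<lambda>(m, j). restrict (case_sum (label i m) (label j l)) ?X) p) = p"
      by (auto simp: fun_eq_iff multi_indices_def PiE_def extensional_def verts_def)
    show "(\<lambda>(m, j). restrict (case_sum (label i m) (label j l)) ?X) ` ?P \<subseteq> ?F"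
    proof clarify
      fix m j assume mj: "m \<in> multi_indices n k" "j \<in> multi_indices n k"
        "compatible d1 i m" "compatible d2 j l" "\<forall>s\<in>{1..k} - S. m s = j s"
      let ?f = "restrict (case_sum (label i m) (label j l)) ?X"
      have c1: "label i m x = label i m y" if "B \<in> d1" "x \<in> B" "y \<in> B" for B x y
        using mj(3) that unfolding compatible_def by blast
      have c2: "label j l x = label j l y" if "B \<in> d2" "x \<in> B" "y \<in> B" for B x y
        using mj(4) that unfolding compatible_def by blast
      have "case_sum (label i m) (label j l) x = case_sum (label i m) (label j l) y"
        if "(x, y) \<in> ?R" for x y
        using that mj(5) unfolding cut_edges_def by (auto intro: c1 c2)
      then have "\<forall>(x, y)\<in>?R. ?f x = ?f y"
        using RX by auto
      moreover have "?f \<in> ?X \<rightarrow>\<^sub>E ?A"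
        using lab[OF i mj(1)] lab[OF mj(2) l] by auto
      moreover have "\<forall>x\<in>?Y. ?f x = g x"
        by (auto simp: verts_def g_def)
      ultimately show "?f \<in> ?X \<rightarrow>\<^sub>E ?A \<and> (\<forall>(x, y)\<in>?R. ?f x = ?f y) \<and> (\<forall>x\<in>?Y. ?f x = g x)"
        by blast
    qed
    have glue: "f (Inl x) = label i (\<lambda>s\<in>{1..k}. f (Inl (Bot s))) x"
      "f (Inr x) = label (\<lambda>s\<in>{1..k}. f (Inr (Top s))) l x"
      if "f \<in> ?F" "x \<in> verts k" for f x
    proof -
      have "f (outer x) = label i l x"
        using that g_outer by auto
      then show "f (Inl x) = label i (\<lambda>s\<in>{1..k}. f (Inl (Bot s))) x"
        "f (Inr x) = label (\<lambda>s\<in>{1..k}. f (Inr (Top s))) l x"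
        using that(2) by (auto simp: verts_def)
    qed
    show "\<forall>f\<in>?F. (\<lambda>(m, j). restrict (case_sum (label i m) (label j l)) ?X)
            ((\<lambda>f. (\<lambda>s\<in>{1..k}. f (Inl (Bot s)), \<lambda>s\<in>{1..k}. f (Inr (Top s)))) f) = f"
    proof
      fix f assume f: "f \<in> ?F"
      show "(\<lambda>(m, j). restrict (case_sum (label i m) (label j l)) ?X)
            ((\<lambda>f. (\<lambda>s\<in>{1..k}. f (Inl (Bot s)), \<lambda>s\<in>{1..k}. f (Inr (Top s)))) f) = f"
      proof
        fix x
        show "(\<lambda>(m, j). restrict (case_sum (label i m) (label j l)) ?X)
            ((\<lambda>f. (\<lambda>s\<in>{1..k}. f (Inl (Bot s)), \<lambda>s\<in>{1..k}. f (Inr (Top s)))) f) x = f x"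
          using f glue[OF f, symmetric] by (cases "x \<in> ?X") (auto simp: PiE_def extensional_def)
      qed
    qed
    show "(\<lambda>f. (\<lambda>s\<in>{1..k}. f (Inl (Bot s)), \<lambda>s\<in>{1..k}. f (Inr (Top s)))) ` ?F \<subseteq> ?P"
    proof
      fix p assume "p \<in> (\<lambda>f. (\<lambda>s\<in>{1..k}. f (Inl (Bot s)), \<lambda>s\<in>{1..k}. f (Inr (Top s)))) ` ?F"
      then obtain f where f: "f \<in> ?F"
        and p: "p = (\<lambda>s\<in>{1..k}. f (Inl (Bot s)), \<lambda>s\<in>{1..k}. f (Inr (Top s)))"
        by blast
      let ?m = "\<lambda>s\<in>{1..k}. f (Inl (Bot s))" and ?j = "\<lambda>s\<in>{1..k}. f (Inr (Top s))"
      have fA: "f x \<in> {1..n}" if "x \<in> ?X" for x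
        using f that by (auto simp: PiE_iff)
      have fR: "f x = f y" if "(x, y) \<in> ?R" for x y
        using f that by auto
      have "?m \<in> multi_indices n k" "?j \<in> multi_indices n k"
        unfolding multi_indices_def using fA by (auto simp: verts_def)
      moreover have "compatible d1 i ?m"
        unfolding compatible_def
      proof (intro ballI)
        fix B x y assume B: "B \<in> d1" "x \<in> B" "y \<in> B"
        then have "(Inl x, Inl y) \<in> ?R" "x \<in> verts k" "y \<in> verts k"
          using d unfolding cut_edges_def by auto
        then show "label i ?m x = label i ?m y"
          using fR glue(1)[OF f] by metis
      qed
      moreover have "compatible d2 ?j l"
        unfolding compatible_def
      proof (intro ballI)
        fix B x y assume B: "B \<in> d2" "x \<in> B" "y \<in> B"
        then have "(Inr x, Inr y) \<in> ?R" "x \<in> verts k" "y \<in> verts k"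
          using d unfolding cut_edges_def by auto
        then show "label ?j l x = label ?j l y"
          using fR glue(2)[OF f] by metis
      qed
      moreover have "?m s = ?j s" if "s \<in> {1..k} - S" for s
        using that by (auto intro!: fR simp: cut_edges_def)
      ultimately show "p \<in> ?P"
        unfolding p by auto
    qed
  qed
  then have card_eq: "card ?P = card ?F"
    by (rule bij_betw_same_card)
  show "card ?P = (if compatible (cut_mult k S d1 d2) i l then
      card {f \<in> (?X - ?R\<^sup>* `` ?Y) \<rightarrow>\<^sub>E ?A. \<forall>(x, y)\<in>?R. x \<notin> ?R\<^sup>* `` ?Y \<longrightarrow> f x = f y} else 0)"
  proof (cases "compatible (cut_mult k S d1 d2) i l")
    case True
    have "g ` ?Y \<subseteq> ?A"
      using lab[OF i l] g_outer by auto
    moreover have "g x = g y" if xy: "x \<in> ?Y" "y \<in> ?Y" "(x, y) \<in> ?R\<^sup>*" for x y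
    proof -
      obtain u v where uv: "x = outer u" "y = outer v" "u \<in> verts k" "v \<in> verts k"
        using xy(1,2) by blast
      then have "label i l u = label i l v"
        using True xy(3) unfolding compatible_cut_mult by blast
      then show ?thesis
        by (simp add: uv g_outer)
    qed
    ultimately have "card ?F =
        card {f \<in> (?X - ?R\<^sup>* `` ?Y) \<rightarrow>\<^sub>E ?A. \<forall>(x, y)\<in>?R. x \<notin> ?R\<^sup>* `` ?Y \<longrightarrow> f x = f y}"
      by (intro card_label_extensions sym_cut_edges RX YX)
    with True card_eq show ?thesis
      by simp
  next
    case False
    have "?F = {}"
    proof (rule equals0I)
      fix f assume f: "f \<in> ?F"
      have "label i l x = label i l y"
        if "x \<in> verts k" "y \<in> verts k" "(outer x, outer y) \<in> ?R\<^sup>*" for x y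
      proof -
        have "f (outer x) = f (outer y)"
          using f that(3) by (intro rtrancl_label_eq[of _ _ ?R f]) auto
        then show ?thesis
          using f that(1,2) g_outer by auto
      qed
      with False show False
        unfolding compatible_cut_mult by blast
    qed
    then have "card ?F = 0"
      by (simp only: card.empty)
    then show ?thesis
      unfolding card_eq using False by presburger
  qed
qed


section \<open>The operators as matrices\<close>

lemma finite_multi_indices: "finite (multi_indices n k)"
  unfolding multi_indices_def by (intro finite_PiE) auto

lemma sum_fun_apply: "(\<Sum>a\<in>A. f a) x = (\<Sum>a\<in>A. f a x)"
  for f :: "'a \<Rightarrow> 'b \<Rightarrow> complex"
  by (induction A rule: infinite_finite_induct) auto

lemma elem_tensor_basis_vec:
  assumes "i \<in> multi_indices n k"
  shows "elem_tensor k (\<lambda>s. basis_vec (i s)) = (\<lambda>j. if j = i then 1 else 0)"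
proof
  fix j
  have "j = i" if "j \<in> extensional {1..k}" "\<forall>s\<in>{1..k}. j s = i s"
    by (rule extensionalityI[of _ "{1..k}"]) (use that assms in \<open>auto simp: multi_indices_def PiE_def\<close>)
  then show "elem_tensor k (\<lambda>s. basis_vec (i s)) j = (if j = i then 1 else 0)"
    using assms
    by (cases "j = i")
      (auto simp: elem_tensor_def basis_vec_def multi_indices_def PiE_def intro: prod_zero)
qed

lemma diagram_act_apply:
  "diagram_act n k d T i =
     (if i \<in> multi_indices n k
      then \<Sum>j\<in>multi_indices n k. T j * of_bool (compatible d i j) else 0)"
proof -
  have "(\<Sum>i'\<in>{i'\<in>multi_indices n k. compatible d i' j}.
           elem_tensor k (\<lambda>s. basis_vec (i' s)) i) =
        (if i \<in> multi_indices n k then of_bool (compatible d i j) else 0)" for j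
  proof -
    have "(\<Sum>i'\<in>{i'\<in>multi_indices n k. compatible d i' j}.
             elem_tensor k (\<lambda>s. basis_vec (i' s)) i) =
          (\<Sum>i'\<in>{i'\<in>multi_indices n k. compatible d i' j}. if i = i' then 1 else 0)"
      by (intro sum.cong) (auto simp: elem_tensor_basis_vec)
    then show ?thesis
      by (simp add: finite_multi_indices)
  qed
  then show ?thesis
    unfolding diagram_act_def by (simp add: sum_fun_apply cscale_def)
qed

definition proj_entry :: "nat \<Rightarrow> nat \<Rightarrow> nat \<Rightarrow> complex" where
  "proj_entry n a b = of_bool (a = b) - 1 / of_nat n"

lemma proj_basis_vec_apply:
  assumes "b \<in> {1..n}"
  shows "proj n (basis_vec b) a = (if a \<in> {1..n} then proj_entry n a b else 0)"
proof -
  have "(\<Sum>j=1..n. basis_vec j a) = (if a \<in> {1..n} then 1 else 0)"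
    unfolding basis_vec_def by simp
  then show ?thesis
    using assms unfolding proj_basis_vec[OF assms] proj_entry_def
    by (simp add: cscale_def sum_fun_apply) (auto simp: basis_vec_def)
qed

lemma proj_tensor_apply:
  "proj_tensor n k T i =
     (if i \<in> multi_indices n k
      then \<Sum>j\<in>multi_indices n k. T j * (\<Prod>s=1..k. proj_entry n (i s) (j s)) else 0)"
proof -
  have "elem_tensor k (\<lambda>s. proj n (basis_vec (j s))) i =
      (if i \<in> multi_indices n k then \<Prod>s=1..k. proj_entry n (i s) (j s) else 0)"
    if j: "j \<in> multi_indices n k" for j
  proof -
    have "proj n (basis_vec (j s)) a = (if a \<in> {1..n} then proj_entry n a (j s) else 0)"
      if "s \<in> {1..k}" for s a
      using j that by (intro proj_basis_vec_apply) (auto simp: multi_indices_def PiE_iff)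
    then have "elem_tensor k (\<lambda>s. proj n (basis_vec (j s))) i =
      (if i \<in> extensional {1..k}
       then \<Prod>s=1..k. if i s \<in> {1..n} then proj_entry n (i s) (j s) else 0 else 0)"
      unfolding elem_tensor_def by auto
    then show ?thesis
    proof (cases "i \<in> multi_indices n k")
      case False
      show ?thesis
      proof (cases "i \<in> extensional {1..k}")
        case True
        with False obtain s where "s \<in> {1..k}" "i s \<notin> {1..n}"
          by (auto simp: multi_indices_def PiE_iff simp del: atLeastAtMost_iff)
        then have "(\<Prod>s=1..k. if i s \<in> {1..n} then proj_entry n (i s) (j s) else 0) = 0"
          by (intro prod_zero) auto
        with False \<open>elem_tensor k _ i = _\<close> show ?thesis
          by simp
      qed (use False \<open>elem_tensor k _ i = _\<close> in auto)
    qed (auto simp: multi_indices_def PiE_iff intro!: prod.cong)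
  qed
  then show ?thesis
    unfolding proj_tensor_def by (simp add: sum_fun_apply cscale_def)
qed

lemma proj_tensor_linear:
  "proj_tensor n k (\<Sum>a\<in>A. c a *\<^sub>c F a) = (\<Sum>a\<in>A. c a *\<^sub>c proj_tensor n k (F a))"
proof
  fix i
  show "proj_tensor n k (\<Sum>a\<in>A. c a *\<^sub>c F a) i = (\<Sum>a\<in>A. c a *\<^sub>c proj_tensor n k (F a)) i"
    unfolding proj_tensor_apply sum_fun_apply cscale_def
    by (auto simp: sum_distrib_right sum_distrib_left mult_ac intro: sum.swap)
qed


section \<open>Diagrams with a singleton block act as zero\<close>

text \<open>Both vanishing results come from the following: if \<open>h\<close> ignores the \<open>s\<close>-th index, the sum over
  that index splits off as the factor \<open>\<Sum>a. x s a\<close>. For singletons in the top row, \<open>x s\<close> is a row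
  of $\pi$; for singletons in the bottom row, it is an element of $W$.\<close>

lemma sum_tensor_eq_0:
  assumes s: "s \<in> {1..k}" and x: "(\<Sum>a=1..n. x s a) = 0"
    and h: "\<And>j a. j \<in> multi_indices n k \<Longrightarrow> a \<in> {1..n} \<Longrightarrow> h (j(s := a)) = h j"
  shows "(\<Sum>j\<in>multi_indices n k. (\<Prod>t=1..k. x t (j t)) * h j) = (0::complex)"
proof -
  let ?J = "({1..k} - {s}) \<rightarrow>\<^sub>E {1..n}"
  have k: "{1..k} = insert s ({1..k} - {s})"
    using s by auto
  have inj: "inj_on (\<lambda>(a, j). j(s := a)) ({1..n} \<times> ?J)"
    by (rule inj_combinator) simp
  have eq: "multi_indices n k = (\<lambda>(a, j). j(s := a)) ` ({1..n} \<times> ?J)"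
    unfolding multi_indices_def by (subst k, subst PiE_insert_eq) (rule refl)
  have hc: "h (j(s := a)) = h (j(s := b))" if "a \<in> {1..n}" "b \<in> {1..n}" "j \<in> ?J" for a b j
  proof -
    have "j(s := b) \<in> multi_indices n k"
      unfolding eq using that by (intro image_eqI[of _ _ "(b, j)"]) auto
    from h[OF this that(1)] show ?thesis
      by simp
  qed
  have "(\<Sum>j\<in>multi_indices n k. (\<Prod>t=1..k. x t (j t)) * h j) =
      (\<Sum>(a, j)\<in>{1..n} \<times> ?J. (\<Prod>t=1..k. x t ((j(s := a)) t)) * h (j(s := a)))"
    unfolding eq by (subst sum.reindex[OF inj]) (simp add: case_prod_unfold)
  \<comment> \<open>Index 1 at \<open>s\<close> is a reference value; it is admissible because \<open>a \<in> {1..n}\<close> forces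
    \<open>n \<ge> 1\<close>.\<close>
  also have "\<dots> = (\<Sum>(a, j)\<in>{1..n} \<times> ?J. x s a * ((\<Prod>t\<in>{1..k} - {s}. x t (j t)) * h (j(s := 1))))"
  proof (intro sum.cong refl, clarify)
    fix a j assume a: "a \<in> {1..n}" and j: "j \<in> ?J"
    have "(\<Prod>t=1..k. x t ((j(s := a)) t)) = x s a * (\<Prod>t\<in>{1..k} - {s}. x t (j t))"
      using s by (subst prod.remove[of _ s]) (auto intro!: arg_cong2[of _ _ _ _ times] prod.cong)
    moreover have "h (j(s := a)) = h (j(s := 1))"
      using a j by (intro hc) auto
    ultimately show "(\<Prod>t=1..k. x t ((j(s := a)) t)) * h (j(s := a)) =
        x s a * ((\<Prod>t\<in>{1..k} - {s}. x t (j t)) * h (j(s := 1)))"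
      by simp
  qed
  also have "\<dots> = (\<Sum>a=1..n. x s a) * (\<Sum>j\<in>?J. (\<Prod>t\<in>{1..k} - {s}. x t (j t)) * h (j(s := 1)))"
    by (simp add: sum_product sum.cartesian_product)
  finally show ?thesis
    using x by simp
qed

lemma sum_W_eq_0:
  assumes "x \<in> W n"
  shows "(\<Sum>a=1..n. x a) = 0"
  using assms unfolding W_def
proof (induction rule: cfun.span_induct_alt)
  case (step c x y)
  then obtain j where j: "2 \<le> j" "j \<le> n" "x = basis_vec j - basis_vec 1"
    by blast
  then have "(\<Sum>a=1..n. x a) = 0"
    by (simp add: sum_subtractf basis_vec_def)
  with step.IH show ?case
    by (simp add: cscale_def sum.distrib flip: sum_distrib_left)
qed auto

lemma sum_W_tensor_eq_0:
  assumes T: "T \<in> W_tensor n k" and s: "s \<in> {1..k}"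
    and h: "\<And>j a. j \<in> multi_indices n k \<Longrightarrow> a \<in> {1..n} \<Longrightarrow> h (j(s := a)) = h j"
  shows "(\<Sum>j\<in>multi_indices n k. T j * h j) = 0"
  using T unfolding W_tensor_def
proof (induction rule: cfun.span_induct_alt)
  case (step c T U)
  then obtain x where x: "\<forall>s\<in>{1..k}. x s \<in> W n" and T: "T = elem_tensor k x"
    by blast
  have "(\<Sum>j\<in>multi_indices n k. T j * h j) =
      (\<Sum>j\<in>multi_indices n k. (\<Prod>t=1..k. x t (j t)) * h j)"
    unfolding T elem_tensor_def by (intro sum.cong) (auto simp: multi_indices_def PiE_def)
  also have "\<dots> = 0"
    using x s by (intro sum_tensor_eq_0[OF s _ h] sum_W_eq_0) auto
  finally show ?case
    using step.IH by (simp add: cscale_def sum.distrib distrib_right mult.assoc flip: sum_distrib_left)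
qed auto

lemma compatible_relabel_singleton:
  assumes "partition_diagram k d" and "{v} \<in> d"
    and "\<And>x. x \<noteq> v \<Longrightarrow> label i' j' x = label i j x"
  shows "compatible d i' j' \<longleftrightarrow> compatible d i j"
proof -
  have "label i' j' x = label i' j' y \<longleftrightarrow> label i j x = label i j y"
    if "B \<in> d" "x \<in> B" "y \<in> B" for B x y
  proof (cases "B = {v}")
    case False
    then have "v \<notin> B"
      using partition_onD2[OF assms(1)[unfolded partition_diagram_def]] assms(2) that(1)
      by (auto dest: disjointD)
    with that have "x \<noteq> v" "y \<noteq> v"
      by auto
    then show ?thesis
      using assms(3) by simp
  qed (use that in auto)
  then show ?thesis
    unfolding compatible_def by blast
qed

lemma proj_diagram_act_eq_0_if_singleton:
  assumes "n \<ge> 1" and d: "partition_diagram k d" and B: "B \<in> d" "card B = 1"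
    and T: "T \<in> W_tensor n k"
  shows "proj_tensor n k (diagram_act n k d T) = 0"
proof -
  obtain v where v: "B = {v}"
    using B(2) by (auto simp: card_1_singleton_iff)
  have vB: "{v} \<in> d"
    using B v by simp
  have "v \<in> verts k"
    using d vB unfolding partition_diagram_def partition_on_def by auto
  then consider s where "s \<in> {1..k}" "v = Top s" | s where "s \<in> {1..k}" "v = Bot s"
    unfolding verts_def by auto
  then show ?thesis
  proof cases
    case (1 s)
    have row: "(\<Sum>b=1..n. proj_entry n a b) = 0" if "a \<in> {1..n}" for a
      using that \<open>n \<ge> 1\<close> by (simp add: proj_entry_def sum_subtractf of_bool_def)
    have "proj_tensor n k (diagram_act n k d T) i = 0" for i
    proof (cases "i \<in> multi_indices n k")
      case True
      have upd: "diagram_act n k d T (j(s := a)) = diagram_act n k d T j"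
        if "j \<in> multi_indices n k" "a \<in> {1..n}" for j a
      proof -
        have "j(s := a) \<in> multi_indices n k"
          using that 1(1) unfolding multi_indices_def by (auto simp: PiE_iff extensional_def)
        moreover have "compatible d (j(s := a)) l \<longleftrightarrow> compatible d j l" for l
        proof (rule compatible_relabel_singleton[OF d vB])
          show "label (j(s := a)) l x = label j l x" if "x \<noteq> v" for x
            using that 1(2) by (cases x) auto
        qed
        ultimately show ?thesis
          using that by (simp add: diagram_act_apply)
      qed
      have "(\<Sum>j\<in>multi_indices n k. (\<Prod>t=1..k. proj_entry n (i t) (j t)) * diagram_act n k d T j) = 0"
        using True 1(1)
        by (intro sum_tensor_eq_0[OF 1(1) _ upd] row) (auto simp: multi_indices_def PiE_iff)
      then show ?thesis
        by (simp add: proj_tensor_apply mult.commute)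
    qed (simp add: proj_tensor_apply)
    then show ?thesis
      by (simp add: fun_eq_iff)
  next
    case (2 s)
    have "(\<Sum>l\<in>multi_indices n k. T l * of_bool (compatible d i l)) = 0" for i
    proof (rule sum_W_tensor_eq_0[OF T 2(1)])
      fix l a
      have "compatible d i (l(s := a)) \<longleftrightarrow> compatible d i l"
      proof (rule compatible_relabel_singleton[OF d vB])
        show "label i (l(s := a)) x = label i l x" if "x \<noteq> v" for x
          using that 2(2) by (cases x) auto
      qed
      then show "(of_bool (compatible d i (l(s := a))) :: complex) = of_bool (compatible d i l)"
        by simp
    qed
    then have "diagram_act n k d T = 0"
      by (simp add: diagram_act_apply fun_eq_iff)
    then show ?thesis
      by (simp add: proj_tensor_apply fun_eq_iff)
  qed
qed


section \<open>Expanding the projection between two diagrams\<close>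

text \<open>This is $\pi^{\otimes k} = \sum_S (-1/n)^{|S|} e_S$ on matrix entries; the last factor is the
  entry of $e_S$.\<close>

lemma prod_proj_entry:
  fixes k :: nat
  shows "(\<Prod>s=1..k. proj_entry n (m s) (j s)) =
     (\<Sum>S\<in>Pow {1..k}. (- 1 / of_nat n) ^ card S * of_bool (\<forall>s\<in>{1..k} - S. m s = j s))"
proof -
  have "(\<Prod>s=1..k. proj_entry n (m s) (j s)) =
      (\<Prod>s=1..k. (- 1 / of_nat n) + of_bool (m s = j s))"
    by (simp add: proj_entry_def)
  also have "\<dots> = (\<Sum>S\<in>Pow {1..k}. (\<Prod>s\<in>S. - 1 / of_nat n) * (\<Prod>s\<in>{1..k} - S. of_bool (m s = j s)))"
    by (rule prod_add) simp
  also have "\<dots> = (\<Sum>S\<in>Pow {1..k}.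
      (- 1 / of_nat n) ^ card S * of_bool (\<forall>s\<in>{1..k} - S. m s = j s))"
  proof (intro sum.cong refl arg_cong2[of _ _ _ _ times])
    show "(\<Prod>s\<in>{1..k} - S. of_bool (m s = j s)) =
        (of_bool (\<forall>s\<in>{1..k} - S. m s = j s) :: complex)" for S
      by (cases "\<forall>s\<in>{1..k} - S. m s = j s") (auto intro: prod_zero)
  qed simp
  finally show ?thesis .
qed

lemma sum_swap_4:
  "(\<Sum>a\<in>A. \<Sum>b\<in>B. \<Sum>c\<in>C. \<Sum>d\<in>D. F a b c d) =
   (\<Sum>d\<in>D. \<Sum>c\<in>C. \<Sum>a\<in>A. \<Sum>b\<in>B. F a b c d)"
proof -
  have "(\<Sum>a\<in>A. \<Sum>b\<in>B. \<Sum>c\<in>C. \<Sum>d\<in>D. F a b c d) =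
      (\<Sum>p\<in>A \<times> B. \<Sum>q\<in>D \<times> C. F (fst p) (snd p) (snd q) (fst q))"
    by (simp add: sum.swap[of _ C D] sum.cartesian_product' case_prod_unfold)
  also have "\<dots> = (\<Sum>d\<in>D. \<Sum>c\<in>C. \<Sum>a\<in>A. \<Sum>b\<in>B. F a b c d)"
    by (subst sum.swap) (simp add: sum.cartesian_product' case_prod_unfold)
  finally show ?thesis .
qed

text \<open>The coefficient of \<open>S\<close> is $(-1/n)^{|S|}$ times the number of labellings from
  \<open>card_inner_labels\<close>.\<close>

lemma diagram_act_proj_diagram_act:
  assumes "partition_diagram k d1" and "partition_diagram k d2"
  obtains c :: "nat set \<Rightarrow> complex" where
    "\<And>T. diagram_act n k d1 (proj_tensor n k (diagram_act n k d2 T)) =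
       (\<Sum>S\<in>Pow {1..k}. c S *\<^sub>c diagram_act n k (cut_mult k S d1 d2) T)"
proof -
  let ?I = "multi_indices n k"
  let ?P = "\<lambda>S i l. {(m, j) \<in> ?I \<times> ?I. compatible d1 i m \<and> compatible d2 j l \<and>
                       (\<forall>s\<in>{1..k} - S. m s = j s)}"
  have "\<forall>S. \<exists>c. \<forall>i\<in>?I. \<forall>l\<in>?I.
      card (?P S i l) = (if compatible (cut_mult k S d1 d2) i l then c else 0)"
    by (intro allI card_inner_labels assms)
  from choice[OF this] obtain c where c: "\<And>S i l. i \<in> ?I \<Longrightarrow> l \<in> ?I \<Longrightarrow>
      card (?P S i l) = (if compatible (cut_mult k S d1 d2) i l then c S else 0)"
    by (auto simp only:)
  have count: "(\<Sum>m\<in>?I. \<Sum>j\<in>?I. of_bool (compatible d1 i m) * of_bool (compatible d2 j l) *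
                  of_bool (\<forall>s\<in>{1..k} - S. m s = j s)) =
      (of_nat (c S) * of_bool (compatible (cut_mult k S d1 d2) i l) :: complex)"
    if "i \<in> ?I" "l \<in> ?I" for S i l
  proof -
    have "(\<Sum>m\<in>?I. \<Sum>j\<in>?I. of_bool (compatible d1 i m) * of_bool (compatible d2 j l) *
             of_bool (\<forall>s\<in>{1..k} - S. m s = j s)) =
        (\<Sum>p\<in>?I \<times> ?I. of_bool (p \<in> ?P S i l) :: complex)"
      unfolding sum.cartesian_product by (intro sum.cong) auto
    also have "\<dots> = of_nat (card (?I \<times> ?I \<inter> {p. p \<in> ?P S i l}))"
      by (intro sum_of_bool_eq finite_cartesian_product finite_multi_indices)
    also have "?I \<times> ?I \<inter> {p. p \<in> ?P S i l} = ?P S i l"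
      by blast
    finally show ?thesis
      unfolding c[OF that] by simp
  qed
  define e :: "nat set \<Rightarrow> complex" where "e S = (- 1 / of_nat n) ^ card S" for S
  have "diagram_act n k d1 (proj_tensor n k (diagram_act n k d2 T)) i =
     (\<Sum>S\<in>Pow {1..k}. (e S * of_nat (c S)) *\<^sub>c diagram_act n k (cut_mult k S d1 d2) T) i" for T i
  proof (cases "i \<in> ?I")
    case True
    have "diagram_act n k d1 (proj_tensor n k (diagram_act n k d2 T)) i =
        (\<Sum>m\<in>?I. \<Sum>j\<in>?I. \<Sum>l\<in>?I. T l *
           (of_bool (compatible d1 i m) * of_bool (compatible d2 j l) *
            (\<Prod>s=1..k. proj_entry n (m s) (j s))))"
      using True
      by (simp add: diagram_act_apply proj_tensor_apply sum_distrib_left sum_distrib_right mult_ac)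
    also have "\<dots> = (\<Sum>m\<in>?I. \<Sum>j\<in>?I. \<Sum>l\<in>?I. \<Sum>S\<in>Pow {1..k}. T l * e S *
           (of_bool (compatible d1 i m) * of_bool (compatible d2 j l) *
            of_bool (\<forall>s\<in>{1..k} - S. m s = j s)))"
      unfolding prod_proj_entry e_def by (simp only: sum_distrib_left mult_ac)
    also have "\<dots> = (\<Sum>S\<in>Pow {1..k}. \<Sum>l\<in>?I. \<Sum>m\<in>?I. \<Sum>j\<in>?I. T l * e S *
           (of_bool (compatible d1 i m) * of_bool (compatible d2 j l) *
            of_bool (\<forall>s\<in>{1..k} - S. m s = j s)))"
      by (rule sum_swap_4)
    also have "\<dots> = (\<Sum>S\<in>Pow {1..k}. \<Sum>l\<in>?I. T l * e S *
           (of_nat (c S) * of_bool (compatible (cut_mult k S d1 d2) i l)))"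
      using True by (intro sum.cong refl) (simp only: count flip: sum_distrib_left)
    also have "\<dots> = (\<Sum>S\<in>Pow {1..k}. (e S * of_nat (c S)) *\<^sub>c diagram_act n k (cut_mult k S d1 d2) T) i"
      using True by (simp add: sum_fun_apply cscale_def diagram_act_apply sum_distrib_left mult_ac)
    finally show ?thesis .
  qed (simp add: sum_fun_apply cscale_def diagram_act_apply)
  then show ?thesis
    by (intro that[of "\<lambda>S. e S * of_nat (c S)"]) (simp add: fun_eq_iff)
qed

theorem corollary2p7:
  fixes k n :: nat and d1 d2 :: diagram
  assumes "k \<ge> 1" and "n \<ge> 2 * k"
    and "d1 \<in> nonsingleton_diagrams k" and "d2 \<in> nonsingleton_diagrams k"
  shows "\<exists>c :: diagram \<Rightarrow> complex.
           compose (W_tensor n k) (bar n k d1) (bar n k d2) =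
           (\<lambda>T\<in>W_tensor n k.
              \<Sum>d\<in>{d \<in> nonsingleton_diagrams k. diagram_le d (diagram_mult k d1 d2)}.
                c d *\<^sub>c bar n k d T)"
proof -
  let ?D = "{d \<in> nonsingleton_diagrams k. diagram_le d (diagram_mult k d1 d2)}"
  let ?d = "\<lambda>S. cut_mult k S d1 d2"
  let ?N = "{S \<in> Pow {1..k}. ?d S \<in> nonsingleton_diagrams k}"
  have pd: "partition_diagram k d1" "partition_diagram k d2"
    using assms unfolding nonsingleton_diagrams_def by auto
  obtain b where b: "\<And>T. diagram_act n k d1 (proj_tensor n k (diagram_act n k d2 T)) =
       (\<Sum>S\<in>Pow {1..k}. b S *\<^sub>c diagram_act n k (?d S) T)"
    using diagram_act_proj_diagram_act[OF pd, of n] by blast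
  \<comment> \<open>Different sets \<open>S\<close> may give the same diagram, so their coefficients are collected.\<close>
  define c where "c d = (\<Sum>S\<in>{S \<in> ?N. ?d S = d}. b S)" for d
  have "nonsingleton_diagrams k \<subseteq> Pow (Pow (verts k))"
    unfolding nonsingleton_diagrams_def partition_diagram_def partition_on_def by auto
  then have fin: "finite ?D"
    by (rule finite_subset[OF subset_trans[rotated]]) (auto simp: verts_def)
  have "bar n k d1 (bar n k d2 T) = (\<Sum>d\<in>?D. c d *\<^sub>c bar n k d T)"
    if T: "T \<in> W_tensor n k" for T
  proof -
    have "bar n k d2 T \<in> W_tensor n k"
      using bar_funcset[of n k d2] T by auto
    then have "bar n k d1 (bar n k d2 T) =
        proj_tensor n k (\<Sum>S\<in>Pow {1..k}. b S *\<^sub>c diagram_act n k (?d S) T)"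
      using T by (simp add: bar_def b)
    also have "\<dots> = (\<Sum>S\<in>Pow {1..k}. b S *\<^sub>c bar n k (?d S) T)"
      using T by (simp add: proj_tensor_linear bar_def)
    also have "\<dots> = (\<Sum>S\<in>?N. b S *\<^sub>c bar n k (?d S) T)"
    proof (rule sum.mono_neutral_right)
      show "\<forall>S\<in>Pow {1..k} - ?N. b S *\<^sub>c bar n k (?d S) T = 0"
      proof
        fix S assume "S \<in> Pow {1..k} - ?N"
        then obtain B where "B \<in> ?d S" "card B = 1"
          using partition_diagram_cut_mult unfolding nonsingleton_diagrams_def by blast
        then have "bar n k (?d S) T = 0"
          using assms T proj_diagram_act_eq_0_if_singleton[OF _ partition_diagram_cut_mult, of n B k S d1 d2 T]
          by (simp add: bar_def)
        then show "b S *\<^sub>c bar n k (?d S) T = 0"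
          by (simp add: cscale_def fun_eq_iff)
      qed
    qed auto
    also have "\<dots> = (\<Sum>d\<in>?D. \<Sum>S\<in>{S \<in> ?N. ?d S = d}. b S *\<^sub>c bar n k (?d S) T)"
      by (rule sum.group[symmetric]) (use fin cut_mult_le in auto)
    also have "\<dots> = (\<Sum>d\<in>?D. c d *\<^sub>c bar n k d T)"
      unfolding c_def cfun.scale_sum_left by (intro sum.cong) auto
    finally show ?thesis .
  qed
  then show ?thesis
    by (intro exI[of _ c]) (auto simp: compose_def)
qed

end
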